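(* Let $\Omega$ and $\Theta$ be nonempty convex sets in normed vector spaces $X$ and $Y$, respectively, let $\sigma\ge 0$ and $1\le p\le\infty$, and equip $X\times Y$ with the $p$-norm. Suppose that $f\colon\Omega\times\Theta\to[-\infty,\infty]$ is $\sigma$-quasiconvex and that $F\colon\Omega\rightrightarrows\Theta$ is an affine process such that $F(x)\ne\emptyset$ for every $x\in\Omega$. Then the function $V\colon\Omega\to[-\infty,\infty]$ defined by $$V(x)=\sup\{f(x,y)\mid y\in F(x)\},\quad x\in\Omega,$$ is $\sigma$-quasiconvex.
   Context: All normed vector spaces are real and nontrivial. The $p$-norm on $X\times Y$ is $\|(x,y)\|=(\|x\|^p+\|y\|^p)^{1/p}$ for $p<\infty$ and $\|(x,y)\|=\max\{\|x\|,\|y\|\}$ for $p=\infty$. Let $\sigma\ge 0$. A function $g\colon C\to[-\infty,\infty]$ on a nonempty convex subset $C$ of a normed vector space is $\sigma$-quasiconvex if $g(\lambda x+(1-\lambda)y)\le\max\{g(x),g(y)\}-\frac{\sigma}{2}\lambda(1-\lambda)\|x-y\|^2$ for all $x,y\in C$ and $0<\lambda<1$. A set-valued map $F\colon\Omega\rightrightarrows\Theta$ assigns to each $x\in\Omega$ a subset $F(x)\subset\Theta$. It is an affine process if $F(\lambda x+(1-\lambda)y)\subset\lambda F(x)+(1-\lambda)F(y)$ for all $x,y\in\Omega$ and $0<\lambda<1$, where the right-hand side is the Minkowski combination of sets. *)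

theory Defs
  imports "HOL-Analysis.Analysis" "HOL-Library.Set_Algebras"
begin

text \<open>
  The product type already carries the Euclidean combination of the two norms as its
  type-class norm, so the \<open>p\<close>-norm is a separate function. For \<open>p < \<infinity>\<close> the convention
  \<open>0 powr a = 0\<close> gives the intended value when a component vanishes.
\<close>
definition pnorm :: "ereal \<Rightarrow> 'a::real_normed_vector \<times> 'b::real_normed_vector \<Rightarrow> real" where
  "pnorm p z =
     (if p = \<infinity> then max (norm (fst z)) (norm (snd z))
      else (norm (fst z) powr real_of_ereal p + norm (snd z) powr real_of_ereal p)
             powr (1 / real_of_ereal p))"

lemma pnorm_infinity: "pnorm \<infinity> (x, y) = max (norm x) (norm y)"
  by (simp add: pnorm_def)

lemma pnorm_finite: "pnorm (ereal p) (x, y) = (norm x powr p + norm y powr p) powr (1 / p)"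
  by (simp add: pnorm_def)

lemma pnorm_2: "pnorm 2 z = norm z"
  by (cases z) (simp add: pnorm_def norm_Pair powr_half_sqrt)

text \<open>
  The norm is the argument \<open>N\<close>, since a product is normed by \<open>pnorm p\<close> rather than by its
  type-class norm. The subtracted term is finite, so the subtraction in \<^typ>\<open>ereal\<close> is never
  of the form \<open>\<infinity> - \<infinity>\<close>. The carrier \<open>C\<close> is meant to be nonempty and convex.
\<close>
definition quasiconvex_on ::
    "('v::real_vector \<Rightarrow> real) \<Rightarrow> real \<Rightarrow> 'v set \<Rightarrow> ('v \<Rightarrow> ereal) \<Rightarrow> bool" where
  "quasiconvex_on N \<sigma> C g \<longleftrightarrow>
     (\<forall>x\<in>C. \<forall>y\<in>C. \<forall>l::real. 0 < l \<and> l < 1 \<longrightarrow>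
        g (l *\<^sub>R x + (1 - l) *\<^sub>R y)
          \<le> max (g x) (g y) - ereal (\<sigma> / 2 * l * (1 - l) * (N (x - y))\<^sup>2))"

text \<open>
  The first conjunct says that \<open>F\<close> is a set-valued map from \<open>\<Omega>\<close> to \<open>\<Theta>\<close>; the sum of sets in
  the second is the Minkowski sum.
\<close>
definition affine_process ::
    "'a::real_vector set \<Rightarrow> 'b::real_vector set \<Rightarrow> ('a \<Rightarrow> 'b set) \<Rightarrow> bool" where
  "affine_process \<Omega> \<Theta> F \<longleftrightarrow>
     (\<forall>x\<in>\<Omega>. F x \<subseteq> \<Theta>) \<and>
     (\<forall>x\<in>\<Omega>. \<forall>y\<in>\<Omega>. \<forall>l::real. 0 < l \<and> l < 1 \<longrightarrow>
        F (l *\<^sub>R x + (1 - l) *\<^sub>R y) \<subseteq> (*\<^sub>R) l ` F x + (*\<^sub>R) (1 - l) ` F y)"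

end

theory Submission
  imports Defs
begin

text \<open>Write \<open>V x\<close> for the supremum of \<open>f (x, y)\<close> over
  \<open>y \<in> F x\<close>. The affine process property splits any \<open>w\<close> in the image
  of a convex combination of \<open>x\<close> and \<open>y\<close> as the same combination of some
  \<open>u \<in> F x\<close> and \<open>v \<in> F y\<close>. Thus the argument of \<open>f\<close>
  is a convex combination of \<open>(x, u)\<close> and \<open>(y, v)\<close>, and quasiconvexity of
  \<open>f\<close> applies. The values of \<open>f\<close> at these two pairs are at most
  \<open>V x\<close> and \<open>V y\<close>, and the distance between the pairs is at least
  \<open>norm (x - y)\<close>, because projection to the first factor is nonexpansive for every
  p-norm (\<open>norm_fst_le_pnorm\<close>). The resulting bound is uniform in \<open>w\<close>, so
  it passes to the supremum.\<close>

lemma norm_fst_le_pnorm: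
  assumes "1 \<le> p"
  shows "norm (fst z) \<le> pnorm p z"
proof (cases p)
  case (real r)
  with assms have r: "1 \<le> r" by simp
  have "norm (fst z) = (norm (fst z) powr r) powr (1 / r)"
    using r by (simp add: powr_powr)
  also have "\<dots> \<le> (norm (fst z) powr r + norm (snd z) powr r) powr (1 / r)"
    using r by (intro powr_mono2) auto
  also have "\<dots> = pnorm p z"
    using real by (simp add: pnorm_def)
  finally show ?thesis .
\<comment> \<open>For \<open>p = \<infinity>\<close> the norm is a maximum;
  \<open>p = -\<infinity>\<close> contradicts \<open>1 \<le> p\<close>.\<close>
qed (use assms in \<open>auto simp: pnorm_def\<close>)

theorem proposition2p13:
  fixes \<Omega> :: "'a::real_normed_vector set"
    and \<Theta> :: "'b::real_normed_vector set"
    and \<sigma> :: real and p :: ereal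
    and f :: "'a \<times> 'b \<Rightarrow> ereal"
    and F :: "'a \<Rightarrow> 'b set"
  assumes "\<exists>x::'a. x \<noteq> 0" and "\<exists>y::'b. y \<noteq> 0"
    and "convex \<Omega>" and "\<Omega> \<noteq> {}"
    and "convex \<Theta>" and "\<Theta> \<noteq> {}"
    and "\<sigma> \<ge> 0" and "1 \<le> p"
    and "quasiconvex_on (pnorm p) \<sigma> (\<Omega> \<times> \<Theta>) f"
    and "affine_process \<Omega> \<Theta> F"
    and "\<forall>x\<in>\<Omega>. F x \<noteq> {}"
  shows "quasiconvex_on norm \<sigma> \<Omega> (\<lambda>x. SUP y\<in>F x. f (x, y))"
  unfolding quasiconvex_on_def
\<comment> \<open>\<open>SUP_least\<close> replaces the supremum on the left by its value at one
  arbitrary \<open>w\<close>.\<close>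
proof (intro ballI allI impI SUP_least)
  fix x y l w
  assume x: "x \<in> \<Omega>" and y: "y \<in> \<Omega>" and l: "0 < l \<and> l < (1::real)"
    and w: "w \<in> F (l *\<^sub>R x + (1 - l) *\<^sub>R y)"
  have "w \<in> (*\<^sub>R) l ` F x + (*\<^sub>R) (1 - l) ` F y"
    using assms(10) x y l w unfolding affine_process_def by blast
  then obtain u v where u: "u \<in> F x" and v: "v \<in> F y"
    and w_eq: "w = l *\<^sub>R u + (1 - l) *\<^sub>R v"
    by (auto elim!: set_plus_elim)
  \<comment> \<open>Here the inclusion of the values of \<open>F\<close> in \<open>\<Theta>\<close>
    enters.\<close>
  have "(x, u) \<in> \<Omega> \<times> \<Theta>" "(y, v) \<in> \<Omega> \<times> \<Theta>"
    using assms(10) x y u v unfolding affine_process_def by blast+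
  then have "f (l *\<^sub>R (x, u) + (1 - l) *\<^sub>R (y, v))
      \<le> max (f (x, u)) (f (y, v)) - ereal (\<sigma> / 2 * l * (1 - l) * (pnorm p ((x, u) - (y, v)))\<^sup>2)"
    using assms(9) l unfolding quasiconvex_on_def by blast
  also have "\<dots> \<le> max (SUP y\<in>F x. f (x, y)) (SUP z\<in>F y. f (y, z))
      - ereal (\<sigma> / 2 * l * (1 - l) * (norm (x - y))\<^sup>2)"
  \<comment> \<open>The maximum grows and the subtracted term shrinks; the latter uses
    \<open>\<sigma> \<ge> 0\<close> and \<open>0 < l < 1\<close>.\<close>
  proof (rule ereal_minus_mono)
    show "max (f (x, u)) (f (y, v)) \<le> max (SUP y\<in>F x. f (x, y)) (SUP z\<in>F y. f (y, z))"
      using u v by (intro max.mono SUP_upper)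
    have "(norm (x - y))\<^sup>2 \<le> (pnorm p ((x, u) - (y, v)))\<^sup>2"
      using norm_fst_le_pnorm[OF assms(8), of "(x, u) - (y, v)"] by (intro power_mono) auto
    then show "ereal (\<sigma> / 2 * l * (1 - l) * (norm (x - y))\<^sup>2)
        \<le> ereal (\<sigma> / 2 * l * (1 - l) * (pnorm p ((x, u) - (y, v)))\<^sup>2)"
      using assms(7) l by (simp add: mult_left_mono)
  qed
  finally show "f (l *\<^sub>R x + (1 - l) *\<^sub>R y, w)
      \<le> max (SUP y\<in>F x. f (x, y)) (SUP z\<in>F y. f (y, z))
        - ereal (\<sigma> / 2 * l * (1 - l) * (norm (x - y))\<^sup>2)"
    by (simp add: w_eq)
qed

end
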